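(* Let $X$ be a Banach space, $(A_n)_{n\in\mathbb N}$ a sequence in $\mathcal B(X)$, $\mu=(\mu_n)_{n\in\mathbb N}$ a growth rate and $\nu=(\nu_n)_{n\in\mathbb N}$ a sequence with $\nu_n\ge 1$ for all $n$. Suppose that there exist a closed subspace $Z\subset X$ and $\beta>0$ such that: (1) for each $\mathbf y=(y_n)_{n\in\mathbb N}\in\ell^1_{\beta,0}$ there exists a unique $\mathbf x=(x_n)_{n\in\mathbb N}\in\ell^\infty_{\beta,Z}$ such that $x_{n+1}-A_nx_n=y_{n+1}$ for all $n\in\mathbb N$; (2) for each $\mathbf y=(y_n)_{n\in\mathbb N}\in\ell^1_{-\beta,0}$ there exists a unique $\mathbf x=(x_n)_{n\in\mathbb N}\in\ell^\infty_{-\beta,Z}$ such that $x_{n+1}-A_nx_n=y_{n+1}$ for all $n\in\mathbb N$. Then $(A_n)_{n\in\mathbb N}$ admits a $(\mu,\nu)$-dichotomy.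
   Context: $\mathbb N=\{0,1,2,\dots\}$. $(X,\|\cdot\|)$ is a Banach space and $\mathcal B(X)$ is the space of bounded linear operators on $X$ with the operator norm. A growth rate $\mu=(\mu_n)_{n\in\mathbb N}$ is a strictly increasing sequence of positive numbers with $\lim_{n\to+\infty}\mu_n=+\infty$. For $m\ge n$, $\mathcal A(m,n)=A_{m-1}\cdots A_n$ if $m>n$ and $\mathcal A(n,n)=\mathrm{Id}$. $(\mu,\nu)$-dichotomy: $(A_n)_{n\in\mathbb N}$ admits a $(\mu,\nu)$-dichotomy if (1) there are projections $P_n$ on $X$, $n\in\mathbb N$, with $A_nP_n=P_{n+1}A_n$ for all $n$; (2) $A_n|_{\operatorname{Ker}P_n}:\operatorname{Ker}P_n\to\operatorname{Ker}P_{n+1}$ is invertible for all $n$; (3) there exist $D,\lambda>0$ such that $\|\mathcal A(m,n)P_n\|\le D\nu_n(\mu_m/\mu_n)^{-\lambda}$ for $m\ge n$ and $\|\mathcal A(m,n)(\mathrm{Id}-P_n)\|\le D\nu_n(\mu_n/\mu_m)^{-\lambda}$ for $m\le n$, where for $m\le n$ one sets $\mathcal A(m,n):=(\mathcal A(n,m)|_{\operatorname{Ker}P_m})^{-1}:\operatorname{Ker}P_n\to\operatorname{Ker}P_m$. Weighted spaces: for $\beta\in\mathbb R$, $\ell^\infty_\beta$ is the Banach space of sequences $\mathbf x=(x_n)_{n\in\mathbb N}\subset X$ with $\|\mathbf x\|_{\infty,\beta}:=\sup_{n}\mu_n^\beta\|x_n\|<+\infty$, and $\ell^1_\beta$ is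 the Banach space of sequences with $\|\mathbf x\|_{1,\beta}:=\sum_{n}\mu_n^\beta\nu_n\|x_n\|<+\infty$. For a closed subspace $Z\subset X$, $\ell^\infty_{\beta,Z}:=\{\mathbf x\in\ell^\infty_\beta: x_0\in Z\}$, and $\ell^1_{\beta,0}:=\{\mathbf x\in\ell^1_\beta: x_0=0\}$. *)

theory Defs
  imports "HOL-Analysis.Analysis"
begin

definition growth_rate :: "(nat \<Rightarrow> real) \<Rightarrow> bool" where
  "growth_rate \<mu> \<longleftrightarrow>
     strict_mono \<mu> \<and> (\<forall>n. 0 < \<mu> n) \<and> filterlim \<mu> at_top sequentially"

(* A(m,n) = A_(m-1) ... A_n for m > n and A(n,n) = Id; the value for m < n is
   irrelevant, see backward_transition. *)
primrec transition ::
  "(nat \<Rightarrow> 'a::real_normed_vector \<Rightarrow>\<^sub>L 'a) \<Rightarrow> nat \<Rightarrow> nat \<Rightarrow> 'a \<Rightarrow>\<^sub>L 'a" where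
  "transition A 0 n = id_blinfun"
| "transition A (Suc m) n =
     (if n \<le> m then A m o\<^sub>L transition A m n else id_blinfun)"

lemma transition_same [simp]: "transition A n n = id_blinfun"
  by (cases n) auto

definition ker_blinfun :: "('a::real_normed_vector \<Rightarrow>\<^sub>L 'b::real_normed_vector) \<Rightarrow> 'a set" where
  "ker_blinfun T = {v. blinfun_apply T v = 0}"

(* For m \<le> n: the inverse of A(n,m) restricted to Ker P_m. Only its values on
   Ker P_n, where it is a genuine inverse by the bijectivity in dichotomy, are used. *)
definition backward_transition ::
  "(nat \<Rightarrow> 'a::real_normed_vector \<Rightarrow>\<^sub>L 'a) \<Rightarrow> (nat \<Rightarrow> 'a \<Rightarrow>\<^sub>L 'a) \<Rightarrow> nat \<Rightarrow> nat \<Rightarrow> 'a \<Rightarrow> 'a" where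
  "backward_transition A P m n =
     inv_into (ker_blinfun (P m)) (blinfun_apply (transition A n m))"

(* onorm is meaningful only for bounded operators, hence the bounded_linear conjunct
   accompanying the second estimate. *)
definition dichotomy ::
  "(nat \<Rightarrow> real) \<Rightarrow> (nat \<Rightarrow> real) \<Rightarrow> (nat \<Rightarrow> 'a::real_normed_vector \<Rightarrow>\<^sub>L 'a) \<Rightarrow> bool" where
  "dichotomy \<mu> \<nu> A \<longleftrightarrow>
    (\<exists>P :: nat \<Rightarrow> 'a \<Rightarrow>\<^sub>L 'a.
       (\<forall>n. P n o\<^sub>L P n = P n) \<and>
       (\<forall>n. A n o\<^sub>L P n = P (Suc n) o\<^sub>L A n) \<and>
       (\<forall>n. bij_betw (blinfun_apply (A n)) (ker_blinfun (P n)) (ker_blinfun (P (Suc n)))) \<and>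
       (\<exists>(D :: real) (a :: real). 0 < D \<and> 0 < a \<and>
          (\<forall>m n. n \<le> m \<longrightarrow>
             norm (transition A m n o\<^sub>L P n) \<le> D * \<nu> n * (\<mu> m / \<mu> n) powr (- a)) \<and>
          (\<forall>m n. m \<le> n \<longrightarrow>
             bounded_linear (\<lambda>v. backward_transition A P m n (v - P n v)) \<and>
             onorm (\<lambda>v. backward_transition A P m n (v - P n v))
               \<le> D * \<nu> n * (\<mu> n / \<mu> m) powr (- a))))"

definition linf_weighted ::
  "(nat \<Rightarrow> real) \<Rightarrow> real \<Rightarrow> (nat \<Rightarrow> 'a::real_normed_vector) set" where
  "linf_weighted \<mu> \<beta> = {x. bdd_above (range (\<lambda>n. \<mu> n powr \<beta> * norm (x n)))}"

definition l1_weighted ::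
  "(nat \<Rightarrow> real) \<Rightarrow> (nat \<Rightarrow> real) \<Rightarrow> real \<Rightarrow> (nat \<Rightarrow> 'a::real_normed_vector) set" where
  "l1_weighted \<mu> \<nu> \<beta> = {x. summable (\<lambda>n. \<mu> n powr \<beta> * \<nu> n * norm (x n))}"

definition linf_weighted_init ::
  "(nat \<Rightarrow> real) \<Rightarrow> real \<Rightarrow> 'a::real_normed_vector set \<Rightarrow> (nat \<Rightarrow> 'a) set" where
  "linf_weighted_init \<mu> \<beta> Z = {x \<in> linf_weighted \<mu> \<beta>. x 0 \<in> Z}"

definition l1_weighted_0 ::
  "(nat \<Rightarrow> real) \<Rightarrow> (nat \<Rightarrow> real) \<Rightarrow> real \<Rightarrow> (nat \<Rightarrow> 'a::real_normed_vector) set" where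
  "l1_weighted_0 \<mu> \<nu> \<beta> = {x \<in> l1_weighted \<mu> \<nu> \<beta>. x 0 = 0}"

end

theory Submission
  imports Defs
begin

text \<open>By uniqueness, the bounded solutions whose right-hand side is a single impulse at a positive
  time are the same for both weights. Zabreiko's lemma on countably subadditive seminorms bounds
  them in both weighted norms, uniformly in the position \<open>n\<close> of the impulse. One bound gives the
  decay forward of \<open>n\<close>, the other the decay backward of \<open>n\<close>. The value at time \<open>n\<close> of the solution
  with impulse \<open>v\<close> is the projection of \<open>v\<close> onto the vectors with decaying forward orbit, along the
  image of \<open>Z\<close> at time \<open>n\<close>.\<close>

subsection \<open>Countably subadditive seminorms\<close>

text \<open>Baire's theorem: if every \<open>closure (F n)\<close> had empty interior, so would
  their union, which is the whole space.\<close>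

lemma ball_subset_closure_if_countable_Un:
  fixes F :: "nat \<Rightarrow> 'b::complete_space set"
  assumes "(\<Union>n. F n) = UNIV"
  obtains n x r where "0 < r" "ball x r \<subseteq> closure (F n)"
proof -
  have "\<exists>n. interior (closure (F n)) \<noteq> {}"
  proof (rule ccontr)
    assume *: "\<not> ?thesis"
    have "Met_TC.mtopology interior_of \<Union>(range (\<lambda>n. closure (F n))) = {}"
    proof (rule Met_TC.metric_Baire_category_alt)
      show "Met_TC.mcomplete TYPE('b)" by (simp add: complete_UNIV)
      fix T assume "T \<in> range (\<lambda>n. closure (F n))"
      then show "closedin Met_TC.mtopology T \<and> Met_TC.mtopology interior_of T = {}"
        using * by (elim imageE) simp
    qed simp
    then have "interior (\<Union>n. closure (F n)) = {}" by simp
    moreover have "(\<Union>n. F n) \<subseteq> (\<Union>n. closure (F n))"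
      by (intro UN_mono closure_subset order_refl)
    ultimately show False using assms by (simp add: top.extremum_unique)
  qed
  then obtain n x where "x \<in> interior (closure (F n))" by blast
  then show thesis
    using that unfolding mem_interior by blast
qed

text \<open>The argument follows the open mapping theorem. By Baire some sublevel set of
  \<open>p\<close> is dense in a ball, which symmetry and convexity move to the origin. Successive
  approximation then writes each small vector as a series whose terms have geometrically decreasing
  \<open>p\<close>, and countable subadditivity sums these values.\<close>

theorem zabreiko:
  fixes p :: "'b::banach \<Rightarrow> real"
  assumes nonneg: "\<And>x. 0 \<le> p x"
    and scale: "\<And>c x. p (c *\<^sub>R x) = \<bar>c\<bar> * p x"
    and csub: "\<And>x. summable (\<lambda>k. norm (x k)) \<Longrightarrow> summable (\<lambda>k. p (x k))
      \<Longrightarrow> p (\<Sum>k. x k) \<le> (\<Sum>k. p (x k))"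
  obtains C where "0 \<le> C" "\<And>x. p x \<le> C * norm x"
proof -
  have p0: "p 0 = 0" using scale[of 0 0] by simp
  have add: "p (x + y) \<le> p x + p y" for x y
  proof -
    \<comment> \<open>Finite subadditivity is the countable one for a series padded with
      zeros.\<close>
    define z where "z k = (if k = 0 then x else if k = 1 then y else 0)" for k :: nat
    have "(\<lambda>k. p (z k)) sums (\<Sum>k\<in>{0,1}. p (z k))"
      by (rule sums_finite) (auto simp: z_def p0)
    moreover have "z sums (\<Sum>k\<in>{0,1}. z k)"
      by (rule sums_finite) (auto simp: z_def)
    moreover have "summable (\<lambda>k. norm (z k))"
      by (rule summable_finite[of "{0,1}"]) (auto simp: z_def)
    ultimately show ?thesis
      using csub[of z] by (simp add: sums_iff) (simp add: z_def)
  qed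
  have "(\<Union>n. {x. p x \<le> real n}) = UNIV"
    using real_arch_simple by auto
  then obtain n x0 r where r: "0 < r" and sub: "ball x0 r \<subseteq> closure {x. p x \<le> real n}"
    by (rule ball_subset_closure_if_countable_Un)
  \<comment> \<open>Half the difference of approximants of \<open>x0 + z\<close> and
    \<open>x0 - z\<close> approximates \<open>z\<close> and stays in the sublevel set, so the centre
    of the ball becomes 0.\<close>
  have approx: "\<exists>a. p a \<le> real n \<and> norm (z - a) < e" if "norm z < r" "0 < e" for z e
  proof -
    have "x0 + z \<in> closure {x. p x \<le> real n}" "x0 - z \<in> closure {x. p x \<le> real n}"
      using sub that by (auto simp: subset_iff dist_norm)
    then obtain a b where ab: "p a \<le> real n" "dist a (x0 + z) < e" "p b \<le> real n" "dist b (x0 - z) < e"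
      using \<open>0 < e\<close> unfolding closure_approachable by blast
    have "p ((1/2) *\<^sub>R (a + (-1) *\<^sub>R b)) \<le> real n"
      using add[of a "(-1) *\<^sub>R b"] ab by (simp only: scale)
    moreover have "norm (z - (1/2) *\<^sub>R (a + (-1) *\<^sub>R b)) < e"
    proof -
      have "z - (1/2) *\<^sub>R (a + (-1) *\<^sub>R b) = (1/2) *\<^sub>R ((x0 + z - a) - (x0 - z - b))"
        by (simp add: algebra_simps flip: scaleR_2)
      then have "norm (z - (1/2) *\<^sub>R (a + (-1) *\<^sub>R b)) = norm ((x0 + z - a) - (x0 - z - b)) / 2"
        by simp
      also have "\<dots> \<le> (norm (x0 + z - a) + norm (x0 - z - b)) / 2"
        by (intro divide_right_mono norm_triangle_ineq4) simp
      also have "\<dots> < e" using ab by (simp add: dist_norm norm_minus_commute)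
      finally show ?thesis .
    qed
    ultimately show ?thesis by blast
  qed
  \<comment> \<open>\<open>approx\<close> scaled by \<open>(1/2)^k\<close>, with an error that falls
    into the next, halved ball.\<close>
  have step: "\<exists>a. p a \<le> real n * (1/2)^k \<and> norm (z - a) < r * (1/2)^Suc k"
    if z: "norm z < r * (1/2)^k" for z and k :: nat
  proof -
    have "norm (2^k *\<^sub>R z) < r"
      using z by (simp add: field_simps)
    from approx[OF this, of "r/2"] r obtain a
      where a: "p a \<le> real n" "norm (2^k *\<^sub>R z - a) < r/2" by auto
    have "z - (1/2)^k *\<^sub>R a = (1/2)^k *\<^sub>R (2^k *\<^sub>R z - a)"
      by (simp add: algebra_simps flip: power_mult_distrib)
    then have "norm (z - (1/2)^k *\<^sub>R a) = (1/2)^k * norm (2^k *\<^sub>R z - a)"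
      by simp
    also have "\<dots> < (1/2)^k * (r/2)" using a by simp
    finally have "norm (z - (1/2)^k *\<^sub>R a) < r * (1/2)^Suc k" by (simp add: mult_ac)
    moreover have "p ((1/2)^k *\<^sub>R a) \<le> real n * (1/2)^k"
      using a by (simp add: scale mult.commute)
    ultimately show ?thesis by blast
  qed
  have main: "p z \<le> 2 * real n" if z: "norm z < r" for z
  proof -
    \<comment> \<open>\<open>f k\<close> is the remainder after \<open>k\<close> approximations, so
      \<open>f k - f (Suc k)\<close> is the next approximant and the series of these differences
      telescopes to \<open>z\<close>.\<close>
    have "\<exists>f. \<forall>k. norm (f k) < r * (1/2)^k \<and> (k = 0 \<longrightarrow> f k = z) \<and>
        p (f k - f (Suc k)) \<le> real n * (1/2)^k"
    proof -
      have "\<exists>f. \<forall>k. (norm (f k) < r * (1/2)^k \<and> (k = 0 \<longrightarrow> f k = z)) \<and>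
          p (f k - f (Suc k)) \<le> real n * (1/2)^k"
      proof (rule dependent_nat_choice)
        fix x and k :: nat assume "norm x < r * (1/2)^k \<and> (k = 0 \<longrightarrow> x = z)"
        then obtain a where "p a \<le> real n * (1/2)^k" "norm (x - a) < r * (1/2)^Suc k"
          using step by blast
        then show "\<exists>y. (norm y < r * (1/2)^Suc k \<and> (Suc k = 0 \<longrightarrow> y = z)) \<and> p (x - y) \<le> real n * (1/2)^k"
          by (intro exI[of _ "x - a"]) auto
      qed (use z in auto)
      then show ?thesis by auto
    qed
    then obtain f where f: "\<And>k. norm (f k) < r * (1/2)^k" "f 0 = z"
      "\<And>k. p (f k - f (Suc k)) \<le> real n * (1/2)^k" by auto
    have geo: "summable (\<lambda>k. c * (1/2::real)^k)" for c
      by (intro summable_mult summable_geometric) simp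
    have "(\<lambda>k. r * (1/2)^k) \<longlonglongrightarrow> 0"
      using summable_LIMSEQ_zero[OF geo] .
    then have "f \<longlonglongrightarrow> 0"
      by (rule Lim_null_comparison[rotated]) (auto intro!: always_eventually less_imp_le f)
    then have sums: "(\<lambda>k. f k - f (Suc k)) sums z"
      using telescope_sums'[of f 0] f(2) by simp
    have "norm (f k - f (Suc k)) \<le> (2 * r) * (1/2)^k" for k
    proof -
      have "norm (f k - f (Suc k)) \<le> norm (f k) + norm (f (Suc k))"
        by (rule norm_triangle_ineq4)
      also have "\<dots> \<le> (2 * r) * (1/2)^k"
        using f(1)[of k] f(1)[of "Suc k"] r by (simp add: field_simps)
      finally show ?thesis .
    qed
    then have "summable (\<lambda>k. norm (f k - f (Suc k)))"
      by (intro summable_comparison_test'[OF geo[of "2*r"], of 0]) simp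
    moreover have ps: "summable (\<lambda>k. p (f k - f (Suc k)))"
      by (intro summable_comparison_test'[OF geo[of "real n"], of 0]) (simp add: nonneg f)
    ultimately have "p z \<le> (\<Sum>k. p (f k - f (Suc k)))"
      using csub[of "\<lambda>k. f k - f (Suc k)"] sums_unique[OF sums] by simp
    also have "\<dots> \<le> (\<Sum>k. real n * (1/2)^k)"
      by (intro suminf_le f ps geo)
    also have "\<dots> = 2 * real n"
      by (simp add: suminf_mult suminf_geometric)
    finally show ?thesis .
  qed
  show thesis
  \<comment> \<open>A nonzero \<open>x\<close> rescaled to norm \<open>r / 2\<close> lies in the
    ball, where \<open>p\<close> is at most \<open>2 * real n\<close>.\<close>
  proof (rule that[of "4 * real n / r"])
    fix x :: 'b
    show "p x \<le> 4 * real n / r * norm x"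
    proof (cases "x = 0")
      case False
      have "p ((r / (2 * norm x)) *\<^sub>R x) \<le> 2 * real n"
        by (rule main) (use r False in auto)
      then show ?thesis
        using r False by (simp add: scale field_simps)
    qed (simp add: p0)
  qed (use r in simp)
qed

text \<open>A gliding hump: if no uniform bound existed, one could pick increasing indices at which
  \<open>q\<close> exceeds \<open>4^k * N\<close>, and the summable weights \<open>(1/2)^k\<close>
  placed there would contradict the weighted bound.\<close>

lemma bounded_if_summable_weights_bounded:
  fixes q :: "nat \<Rightarrow> 'v \<Rightarrow> real" and N :: "'v \<Rightarrow> real"
  assumes N: "\<And>v. 0 \<le> N v"
    and bnd: "\<And>c. (\<And>n. 0 \<le> c n) \<Longrightarrow> summable c \<Longrightarrow> \<exists>C. \<forall>n v. c n * q n v \<le> C * N v"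
  shows "\<exists>C. \<forall>n v. q n v \<le> C * N v"
proof (rule ccontr)
  assume unb: "\<not> ?thesis"
  have geo: "summable (\<lambda>n. (1/2::real)^n)" by (intro summable_geometric) simp
  obtain B where B: "\<And>n v. (1/2)^n * q n v \<le> B * N v"
    using bnd[OF _ geo] by auto
  \<comment> \<open>Unboundedness already occurs beyond any \<open>M\<close>: for
    \<open>n < M\<close> the bound with weights \<open>(1/2)^n\<close> controls \<open>q n\<close>
    by a multiple of \<open>N\<close>.\<close>
  have large: "\<exists>n\<ge>M. \<exists>v. 4^k * N v < q n v" for M k :: nat
  proof (rule ccontr)
    assume "\<not> ?thesis"
    then have *: "q n v \<le> 4^k * N v" if "M \<le> n" for n v using that by (meson not_le)
    have "q n v \<le> (4^k + 2^M * \<bar>B\<bar>) * N v" for n v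
    proof (cases "M \<le> n")
      case True
      with *[of n v] N[of v] show ?thesis by (simp add: algebra_simps add_increasing2)
    next
      case False
      have "q n v \<le> 2^n * (B * N v)"
        using B[of n v] by (simp add: field_simps)
      also have "\<dots> \<le> 2^n * (\<bar>B\<bar> * N v)"
        using N[of v] by (intro mult_left_mono mult_right_mono) auto
      also have "\<dots> \<le> 2^M * (\<bar>B\<bar> * N v)"
        using False N[of v] by (intro mult_right_mono power_increasing) auto
      finally show ?thesis using N[of v] by (simp add: algebra_simps add_increasing)
    qed
    with unb show False by blast
  qed
  have "\<exists>g. \<forall>k. (\<exists>v. 4^k * N v < q (g k) v) \<and> g k < g (Suc k)"
  proof (rule dependent_nat_choice)
    show "\<exists>n. \<exists>v. 4^0 * N v < q n v" using large[of 0 0] by blast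
  next
    fix n k :: nat
    show "\<exists>m. (\<exists>v. 4^Suc k * N v < q m v) \<and> n < m"
      using large[of "Suc n" "Suc k"] by auto
  qed
  then obtain g where g: "\<And>k. \<exists>v. 4^k * N v < q (g k) v" "\<And>k. g k < g (Suc k)" by auto
  have mono: "strict_mono g" using g(2) by (simp add: strict_mono_Suc_iff)
  then have inj: "inj g" by (rule strict_mono_imp_inj_on)
  define c where "c n = (if n \<in> range g then (1/2::real)^(inv g n) else 0)" for n
  have cg: "c (g k) = (1/2)^k" for k using inj by (simp add: c_def)
  have "summable c"
    using summable_mono_reindex[OF mono, of c] geo by (simp add: cg) (simp add: c_def)
  moreover have "0 \<le> c n" for n by (simp add: c_def)
  ultimately obtain C where C: "\<And>n v. c n * q n v \<le> C * N v"
    using bnd by blast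
  \<comment> \<open>The weight \<open>(1/2)^k\<close> leaves \<open>2^k\<close> of the factor
    \<open>4^k\<close>; the strict inequality forces \<open>N v\<close> to be nonzero, so it
    cancels.\<close>
  have "2^k < C" for k
  proof -
    obtain v where v: "4^k * N v < q (g k) v" using g(1) by blast
    have "2^k * N v = (1/2)^k * (4^k * N v)"
      by (simp flip: power_mult_distrib mult.assoc)
    also have "\<dots> < (1/2)^k * q (g k) v" using v by simp
    also have "\<dots> \<le> C * N v" using C[of "g k" v] by (simp add: cg)
    finally show ?thesis
      using N[of v] by (simp add: mult_less_cancel_right)
  qed
  moreover obtain k where "C < 2^k" using real_arch_pow[of 2 C] by auto
  ultimately show False by (meson less_asym)
qed

subsection \<open>Solution operators on weighted spaces\<close>

definition bounded_solution ::
  "(nat \<Rightarrow> 'a::real_normed_vector \<Rightarrow>\<^sub>L 'a) \<Rightarrow> (nat \<Rightarrow> real) \<Rightarrow> 'a set \<Rightarrow> (nat \<Rightarrow> 'a) \<Rightarrow> (nat \<Rightarrow> 'a) \<Rightarrow> bool"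
  where "bounded_solution A a Z y x \<longleftrightarrow>
    bdd_above (range (\<lambda>n. a n * norm (x n))) \<and> x 0 \<in> Z \<and>
    (\<forall>n. x (Suc n) - A n (x n) = y (Suc n))"

definition impulse :: "nat \<Rightarrow> 'a \<Rightarrow> nat \<Rightarrow> 'a::zero" where
  "impulse n v = (\<lambda>k. if k = n then v else 0)"

text \<open>Zabreiko's lemma asks for a type of class \<open>banach\<close>; bounded continuous
  functions will serve as that type.\<close>

instance bcontfun :: (metric_space, banach) banach ..

text \<open>The weights \<open>a\<close> on solutions and \<open>w\<close> on right-hand sides are
  kept abstract, so that the exponents \<beta> and -\<beta> become two instances of one
  argument.\<close>

locale weighted_admissibility =
  fixes A :: "nat \<Rightarrow> 'a::banach \<Rightarrow>\<^sub>L 'a" and a w :: "nat \<Rightarrow> real" and Z :: "'a set"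
  assumes a_pos: "\<And>n. 0 < a n"
    and w_pos: "\<And>n. 0 < w n"
    and subspace_Z: "subspace Z"
    and closed_Z: "closed Z"
    and ex1: "\<And>y. y 0 = 0 \<Longrightarrow> summable (\<lambda>n. w n * norm (y n)) \<Longrightarrow> \<exists>!x. bounded_solution A a Z y x"
begin

definition admissible :: "(nat \<Rightarrow> 'a) \<Rightarrow> bool" where
  "admissible y \<longleftrightarrow> y 0 = 0 \<and> summable (\<lambda>n. w n * norm (y n))"

definition sol :: "(nat \<Rightarrow> 'a) \<Rightarrow> nat \<Rightarrow> 'a" where
  "sol y = (THE x. bounded_solution A a Z y x)"

definition solnorm :: "(nat \<Rightarrow> 'a) \<Rightarrow> real" where
  "solnorm y = (SUP m. a m * norm (sol y m))"

lemma sol: "admissible y \<Longrightarrow> bounded_solution A a Z y (sol y)"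
  unfolding admissible_def sol_def by (intro theI'[of "bounded_solution A a Z y"] ex1) auto

lemma sol_eqI: "admissible y \<Longrightarrow> bounded_solution A a Z y x \<Longrightarrow> sol y = x"
  using ex1[of y] sol[of y] unfolding admissible_def by (blast elim: ex1E)

lemma solnorm_upper: "admissible y \<Longrightarrow> a m * norm (sol y m) \<le> solnorm y"
  using sol unfolding solnorm_def bounded_solution_def by (intro cSUP_upper) auto

lemma solnorm_least: "(\<And>m. a m * norm (sol y m) \<le> C) \<Longrightarrow> solnorm y \<le> C"
  unfolding solnorm_def by (intro cSUP_least) auto

lemma solnorm_nonneg: "admissible y \<Longrightarrow> 0 \<le> solnorm y"
  using solnorm_upper[of y 0] a_pos[of 0] by (meson mult_nonneg_nonneg less_imp_le norm_ge_zero order_trans)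

lemma admissible_scaleR: "admissible y \<Longrightarrow> admissible (\<lambda>n. c *\<^sub>R y n)"
  unfolding admissible_def using summable_mult[of "\<lambda>n. w n * norm (y n)" "\<bar>c\<bar>"]
  by (simp add: mult_ac)

lemma sol_scaleR:
  assumes "admissible y"
  shows "sol (\<lambda>n. c *\<^sub>R y n) = (\<lambda>n. c *\<^sub>R sol y n)"
proof (rule sol_eqI[OF admissible_scaleR[OF assms]])
  have "bdd_above (range (\<lambda>n. a n * norm (c *\<^sub>R sol y n)))"
  proof (rule bdd_aboveI2)
    show "a n * norm (c *\<^sub>R sol y n) \<le> \<bar>c\<bar> * solnorm y" for n
      using mult_left_mono[OF solnorm_upper[OF assms, of n], of "\<bar>c\<bar>"] by (simp add: mult_ac)
  qed
  moreover have "c *\<^sub>R sol y (Suc n) - A n (c *\<^sub>R sol y n) = c *\<^sub>R y (Suc n)" for n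
    using sol[OF assms] unfolding bounded_solution_def
    by (simp add: blinfun.scaleR_right flip: scaleR_right_diff_distrib)
  ultimately show "bounded_solution A a Z (\<lambda>n. c *\<^sub>R y n) (\<lambda>n. c *\<^sub>R sol y n)"
    using sol[OF assms] subspace_Z by (simp add: bounded_solution_def subspace_scale)
qed

lemma solnorm_scaleR:
  assumes "admissible y"
  shows "solnorm (\<lambda>n. c *\<^sub>R y n) = \<bar>c\<bar> * solnorm y"
proof -
  have le: "solnorm (\<lambda>n. c *\<^sub>R y n) \<le> \<bar>c\<bar> * solnorm y" if "admissible y" for c y
  proof (rule solnorm_least)
    show "a m * norm (sol (\<lambda>n. c *\<^sub>R y n) m) \<le> \<bar>c\<bar> * solnorm y" for m
      using mult_left_mono[OF solnorm_upper[OF that, of m], of "\<bar>c\<bar>"]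
      by (simp add: sol_scaleR[OF that] mult_ac)
  qed
  show ?thesis
  proof (cases "c = 0")
    case True
    then show ?thesis by (simp add: solnorm_def sol_scaleR[OF assms, of 0, simplified])
  next
    case False
    \<comment> \<open>The reverse inequality is the first one for the factor
      \<open>inverse c\<close> and the scaled right-hand side.\<close>
    have "solnorm y \<le> \<bar>inverse c\<bar> * solnorm (\<lambda>n. c *\<^sub>R y n)"
      using le[OF admissible_scaleR[OF assms, of c], of "inverse c"] False by simp
    then have "\<bar>c\<bar> * solnorm y \<le> solnorm (\<lambda>n. c *\<^sub>R y n)"
      using False by (simp add: field_simps)
    with le[OF assms, of c] show ?thesis by simp
  qed
qed

text \<open>The solutions sum absolutely at each time. Continuity of each \<open>A n\<close> and
  closedness of \<open>Z\<close> make the pointwise sum a bounded solution for \<open>Y\<close>, and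
  uniqueness identifies it with \<open>sol Y\<close>.\<close>

lemma solnorm_countably_subadditive:
  assumes adm: "\<And>k. admissible (y k)" and admY: "admissible Y"
    and sums: "\<And>n. (\<lambda>k. y k n) sums Y n"
    and summ: "summable (\<lambda>k. solnorm (y k))"
  shows "solnorm Y \<le> (\<Sum>k. solnorm (y k))"
proof -
  define x where "x k = sol (y k)" for k
  have x: "bounded_solution A a Z (y k) (x k)" for k
    unfolding x_def by (rule sol[OF adm])
  have xb: "norm (x k m) \<le> inverse (a m) * solnorm (y k)" for k m
    using solnorm_upper[OF adm, of m k] a_pos[of m] by (simp add: x_def field_simps)
  have nsum: "summable (\<lambda>k. norm (x k m))" for m
    by (intro summable_comparison_test'[OF summable_mult[OF summ, of "inverse (a m)"], of 0]) (simp add: xb)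
  define X where "X m = (\<Sum>k. x k m)" for m
  have Xsums: "(\<lambda>k. x k m) sums X m" for m
    unfolding X_def by (rule summable_sums[OF summable_norm_cancel[OF nsum]])
  have Xb: "a m * norm (X m) \<le> (\<Sum>k. solnorm (y k))" for m
  proof -
    have "norm (X m) \<le> (\<Sum>k. norm (x k m))"
      unfolding X_def by (rule summable_norm[OF nsum])
    also have "\<dots> \<le> (\<Sum>k. inverse (a m) * solnorm (y k))"
      by (intro suminf_le xb nsum summable_mult summ)
    also have "\<dots> = inverse (a m) * (\<Sum>k. solnorm (y k))"
      by (rule suminf_mult[OF summ])
    finally show ?thesis using a_pos[of m] by (simp add: field_simps)
  qed
  have "bounded_solution A a Z Y X"
    unfolding bounded_solution_def
  proof (intro conjI allI)
    show "bdd_above (range (\<lambda>n. a n * norm (X n)))"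
      by (rule bdd_aboveI2[OF Xb])
    have "(\<Sum>k<N. x k 0) \<in> Z" for N
      using x unfolding bounded_solution_def by (intro subspace_sum[OF subspace_Z]) blast
    moreover have "(\<lambda>N. \<Sum>k<N. x k 0) \<longlonglongrightarrow> X 0"
      using Xsums[of 0] by (simp add: sums_def)
    ultimately show "X 0 \<in> Z"
      by (rule closed_sequentially[OF closed_Z])
    fix n
    have "(\<lambda>k. x k (Suc n) - A n (x k n)) sums (X (Suc n) - A n (X n))"
      by (intro sums_diff Xsums bounded_linear.sums[OF blinfun.bounded_linear_right])
    moreover have "x k (Suc n) - A n (x k n) = y k (Suc n)" for k
      using x[of k] by (simp add: bounded_solution_def)
    ultimately show "X (Suc n) - A n (X n) = Y (Suc n)"
      using sums_unique2[OF _ sums[of "Suc n"]] by simp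
  qed
  then have "sol Y = X" by (rule sol_eqI[OF admY])
  then show ?thesis using Xb by (intro solnorm_least) simp
qed

lemma admissible_impulse: "0 < n \<Longrightarrow> admissible (impulse n v)"
  unfolding admissible_def impulse_def
  by (auto intro!: summable_finite[of "{n}"] split: if_splits)

text \<open>Zabreiko's lemma is applied on the Banach space of bounded continuous functions on the
  reals, whose samples at the integers are turned into admissible right-hand sides by an
  arbitrary summable weight; since the weight is arbitrary, the resulting bounds are uniform in
  the position of the impulse.\<close>

theorem impulse_bound:
  obtains C where "\<And>n v m. 0 < n \<Longrightarrow> a m * norm (sol (impulse n v) m) \<le> C * w n * norm v"
proof -
  define q where "q n v = (if n = 0 then 0 else solnorm (impulse n v) / w n)" for n and v :: 'a
  have "\<exists>C. \<forall>n v. q n v \<le> C * norm v"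
  proof (rule bounded_if_summable_weights_bounded)
    fix c :: "nat \<Rightarrow> real" assume c0: "\<And>n. 0 \<le> c n" and c: "summable c"
    \<comment> \<open>The factor \<open>c n / w n\<close> gives
      \<open>w n * norm (Y f n) \<le> norm f * c n\<close>, which is summable.\<close>
    define Y where "Y f n = (if n = 0 then 0 else (c n / w n) *\<^sub>R apply_bcontfun f (real n))"
      for f :: "real \<Rightarrow>\<^sub>C 'a" and n
    have adm: "admissible (Y f)" for f
      unfolding admissible_def
    proof
      have "norm (w n * norm (Y f n)) \<le> norm f * c n" for n
        using mult_left_mono[OF norm_bounded[of f "real n"] c0[of n]] w_pos[of n] c0[of n]
        by (auto simp: Y_def mult_ac)
      then show "summable (\<lambda>n. w n * norm (Y f n))"
        by (intro summable_comparison_test'[OF summable_mult[OF c, of "norm f"], of 0]) simp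
    qed (simp add: Y_def)
    have hom: "solnorm (Y (r *\<^sub>R f)) = \<bar>r\<bar> * solnorm (Y f)" for r f
    proof -
      have "Y (r *\<^sub>R f) = (\<lambda>n. r *\<^sub>R Y f n)" by (auto simp: Y_def)
      then show ?thesis by (simp add: solnorm_scaleR[OF adm])
    qed
    have sub: "solnorm (Y (\<Sum>k. f k)) \<le> (\<Sum>k. solnorm (Y (f k)))"
      if f: "summable (\<lambda>k. norm (f k))" "summable (\<lambda>k. solnorm (Y (f k)))" for f
    proof (rule solnorm_countably_subadditive[OF adm adm _ f(2)])
      fix n
      \<comment> \<open>Evaluation at a point is continuous, so norm convergence of the series of
        functions yields convergence of the right-hand sides at each time.\<close>
      have "bounded_linear (\<lambda>g :: real \<Rightarrow>\<^sub>C 'a. apply_bcontfun g (real n))"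
        by (rule bounded_linear_intro[of _ 1]) (auto simp: norm_bounded)
      from bounded_linear.sums[OF this summable_sums[OF summable_norm_cancel[OF f(1)]]]
      show "(\<lambda>k. Y (f k) n) sums Y (\<Sum>k. f k) n"
        by (auto simp: Y_def intro!: bounded_linear.sums[OF bounded_linear_scaleR_right])
    qed
    obtain C where C: "0 \<le> C" "\<And>f. solnorm (Y f) \<le> C * norm f"
      using zabreiko[of "\<lambda>f. solnorm (Y f)", OF solnorm_nonneg[OF adm] hom sub] by blast
    have "c n * q n v \<le> C * norm v" for n v
    proof (cases "n = 0")
      case False
      \<comment> \<open>A tent of height \<open>v\<close> at \<open>n\<close> that vanishes at all
        other integers, so its samples form the impulse.\<close>
      define h where "h t = max 0 (1 - \<bar>t - real n\<bar>) *\<^sub>R v" for t :: real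
      have h_le: "norm (h t) \<le> norm v" for t
        by (auto simp: h_def max_def intro: mult_left_le_one_le)
      have h_nat: "h (real k) = impulse n v k" for k
        by (auto simp: h_def impulse_def max_def)
      define f where "f = Bcontfun h"
      have "h \<in> bcontfun"
        by (rule bcontfun_normI[OF _ h_le]) (auto simp: h_def intro!: continuous_intros)
      then have f: "apply_bcontfun f = h"
        by (simp add: f_def Bcontfun_inverse)
      have "Y f = (\<lambda>k. (c n / w n) *\<^sub>R impulse n v k)"
        using False by (auto simp: Y_def f h_nat impulse_def)
      then have "solnorm (Y f) = c n * q n v"
        using False w_pos[of n] c0[of n] by (simp add: solnorm_scaleR admissible_impulse q_def)
      moreover have "norm f \<le> norm v"
        by (rule norm_bound) (simp add: f h_le)
      ultimately show ?thesis
        using C(2)[of f] mult_left_mono[OF _ C(1), of "norm f" "norm v"] by simp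
    qed (use C in \<open>simp add: q_def\<close>)
    then show "\<exists>C. \<forall>n v. c n * q n v \<le> C * norm v" by blast
  qed simp
  then obtain C where C: "\<And>n v. q n v \<le> C * norm v" by blast
  show thesis
  proof (rule that)
    fix n m :: nat and v :: 'a assume n: "0 < n"
    have "a m * norm (sol (impulse n v) m) \<le> solnorm (impulse n v)"
      by (rule solnorm_upper[OF admissible_impulse[OF n]])
    also have "\<dots> \<le> C * w n * norm v"
      using C[of n v] n w_pos[of n] by (simp add: q_def field_simps)
    finally show "a m * norm (sol (impulse n v) m) \<le> C * w n * norm v" .
  qed
qed

end

subsection \<open>The dichotomy of a Green function\<close>

lemma transition_compose:
  "k \<le> n \<Longrightarrow> n \<le> m \<Longrightarrow> transition A m n (transition A n k v) = transition A m k v"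
proof (induction m)
  case (Suc m)
  then show ?case by (cases "n = Suc m") (auto simp: le_Suc_eq)
qed simp

lemma transition_homogeneous:
  fixes A :: "nat \<Rightarrow> 'a::real_normed_vector \<Rightarrow>\<^sub>L 'a"
  assumes "n \<le> m" "\<And>k. n \<le> k \<Longrightarrow> k < m \<Longrightarrow> x (Suc k) = A k (x k)"
  shows "transition A m n (x n) = x m"
  using assms by (induction m rule: dec_induct) auto

text \<open>\<open>G n v\<close> is the response to the impulse \<open>v\<close> at a time
  \<open>n > 0\<close>. Both bounds hold at all times; \<open>G_stable\<close> expresses decay for
  \<open>m \<ge> n\<close> and \<open>G_unstable\<close> for \<open>m \<le> n\<close>.
  \<open>Z_unstable\<close> says that no nonzero orbit issuing from \<open>Z\<close> is bounded in
  the growing weight. Linearity of the projections will come from uniqueness of a splitting.\<close>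

locale green_function =
  fixes A :: "nat \<Rightarrow> 'a::real_normed_vector \<Rightarrow>\<^sub>L 'a" and \<mu> \<nu> :: "nat \<Rightarrow> real" and \<beta> C :: real
    and Z :: "'a set" and G :: "nat \<Rightarrow> 'a \<Rightarrow> nat \<Rightarrow> 'a"
  assumes \<mu>_mono: "strict_mono \<mu>" and \<mu>_pos: "\<And>n. 0 < \<mu> n"
    and \<nu>_ge_1: "\<And>n. 1 \<le> \<nu> n" and \<beta>_pos: "0 < \<beta>" and C_nonneg: "0 \<le> C"
    and subspace_Z: "subspace Z"
    and G_init: "\<And>n v. 0 < n \<Longrightarrow> G n v 0 \<in> Z"
    and G_step: "\<And>n v k. 0 < n \<Longrightarrow> G n v (Suc k) = A k (G n v k) + impulse n v (Suc k)"
    and G_stable: "\<And>n v m. 0 < n \<Longrightarrow>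
      norm (G n v m) \<le> C * \<nu> n * (\<mu> m / \<mu> n) powr (- \<beta>) * norm v"
    and G_unstable: "\<And>n v m. 0 < n \<Longrightarrow>
      norm (G n v m) \<le> C * \<nu> n * (\<mu> n / \<mu> m) powr (- \<beta>) * norm v"
    and Z_unstable: "\<And>z B. z \<in> Z \<Longrightarrow>
      (\<And>m. \<mu> m powr \<beta> * norm (transition A m 0 z) \<le> B) \<Longrightarrow> z = 0"
begin

text \<open>\<open>S n\<close> and \<open>U n\<close> are the stable and unstable subspaces at time
  \<open>n\<close>; they become the range and the kernel of the projection.\<close>

definition S :: "nat \<Rightarrow> 'a set" where
  "S n = {v. \<exists>B. \<forall>m\<ge>n. \<mu> m powr \<beta> * norm (transition A m n v) \<le> B}"

definition U :: "nat \<Rightarrow> 'a set" where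
  "U n = transition A n 0 ` Z"

text \<open>No impulse is available at time 0, so there the projection is pulled back along
  \<^term>\<open>A 0\<close> from time 1.\<close>

definition Q :: "nat \<Rightarrow> 'a \<Rightarrow> 'a" where
  "Q n v = (if n = 0 then v + G 1 (A 0 v) 0 else G n v n)"

text \<open>For \<open>m \<le> n\<close> this is the backward evolution to time \<open>m\<close> of
  the unstable component of \<open>v\<close> at time \<open>n\<close>. Before the impulse that
  component is carried by the Green function with the opposite sign.\<close>

definition R :: "nat \<Rightarrow> nat \<Rightarrow> 'a \<Rightarrow> 'a" where
  "R m n v = (if m < n then - G n v m else v - Q n v)"

text \<open>Bounds the correction \<open>G 1 (A 0 v) 0\<close> in the projection at time 0, relative
  to \<open>norm v\<close>.\<close>

definition K :: real where
  "K = C * \<nu> 1 * norm (A 0)"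

text \<open>A common constant for all cases: \<open>1 + C\<close> covers the complementary
  projection at positive times, \<open>1 + K\<close> the projection at time 0, and the last summand
  pays for replacing \<mu> at 1 by \<mu> at 0 in the ratio of the decay estimate.\<close>

definition D :: real where
  "D = 1 + C + K + K * (\<mu> 1 / \<mu> 0) powr \<beta>"

lemma K_nonneg: "0 \<le> K"
  using C_nonneg \<nu>_ge_1[of 1] by (simp add: K_def)

lemma D_pos: "0 < D" and D_ge: "1 + C \<le> D" "1 + K \<le> D" "K * (\<mu> 1 / \<mu> 0) powr \<beta> \<le> D"
  using K_nonneg C_nonneg by (auto simp: D_def intro!: add_pos_nonneg add_nonneg_nonneg mult_nonneg_nonneg)

lemma ratio_nonneg: "0 \<le> D * \<nu> n * r powr s"
  using D_pos \<nu>_ge_1[of n] by simp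

lemma C_le_D: "C * \<nu> n * r powr s * norm v \<le> D * \<nu> n * r powr s * norm v"
  using D_ge(1) \<nu>_ge_1[of n] by (intro mult_right_mono) auto

lemma G_forward: "0 < n \<Longrightarrow> n \<le> m \<Longrightarrow> transition A m n (G n v n) = G n v m"
  by (rule transition_homogeneous) (auto simp: G_step impulse_def)

lemma G_backward: "m < n \<Longrightarrow> transition A m 0 (G n v 0) = G n v m"
  by (rule transition_homogeneous) (auto simp: G_step impulse_def)

text \<open>One step of \<open>A 0\<close> turns the summand \<open>v\<close> of
  \<open>Q 0 v\<close> into \<open>A 0 v\<close>, exactly the impulse that
  \<open>G 1 (A 0 v)\<close> receives at time 1.\<close>

lemma Q_0_forward:
  assumes "0 < m"
  shows "transition A m 0 (Q 0 v) = G 1 (A 0 v) m"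
proof -
  have "A 0 (Q 0 v) = G 1 (A 0 v) 1"
    using G_step[of 1 "A 0 v" 0] by (simp add: Q_def impulse_def blinfun.add_right)
  then have "transition A 1 0 (Q 0 v) = G 1 (A 0 v) 1" by simp
  then show ?thesis
    using assms transition_compose[of 0 1 m A "Q 0 v"] G_forward[of 1 m "A 0 v"] by simp
qed

lemma G_1_0_le: "norm (G 1 (A 0 v) 0) \<le> K * norm v"
proof -
  have "norm (G 1 (A 0 v) 0) \<le> C * \<nu> 1 * (\<mu> 1 / \<mu> 0) powr (- \<beta>) * norm (A 0 v)"
    by (rule G_unstable) simp
  also have "\<dots> \<le> C * \<nu> 1 * 1 * (norm (A 0) * norm v)"
  proof (intro mult_mono norm_blinfun)
    have "\<mu> 0 < \<mu> 1" using \<mu>_mono by (simp add: strict_mono_less)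
    then show "(\<mu> 1 / \<mu> 0) powr (- \<beta>) \<le> 1"
      using \<mu>_pos[of 0] \<beta>_pos powr_mono[of "- \<beta>" 0 "\<mu> 1 / \<mu> 0"] by simp
  qed (use C_nonneg \<nu>_ge_1[of 1] in auto)
  finally show ?thesis by (simp add: K_def mult_ac)
qed

lemma Q_forward:
  assumes "n \<le> m"
  shows "norm (transition A m n (Q n v)) \<le> D * \<nu> n * (\<mu> m / \<mu> n) powr (- \<beta>) * norm v"
proof -
  consider "0 < n" | "n = 0" "m = 0" | "n = 0" "0 < m" by auto
  then show ?thesis
  proof cases
    case 1
    then show ?thesis
      using G_stable[OF 1, of v m] C_le_D[of n "\<mu> m / \<mu> n" "- \<beta>" v] assms
      by (simp add: Q_def G_forward)
  next
    case 2
    have "norm (Q 0 v) \<le> norm v + norm (G 1 (A 0 v) 0)"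
      by (simp add: Q_def norm_triangle_ineq)
    also have "\<dots> \<le> (1 + K) * norm v"
      using G_1_0_le[of v] by (simp add: algebra_simps)
    also have "\<dots> \<le> (D * \<nu> 0) * norm v"
      using D_ge(2) D_pos \<nu>_ge_1[of 0] mult_mono[of "1 + K" D 1 "\<nu> 0"]
      by (intro mult_right_mono) auto
    finally show ?thesis
      using 2 \<mu>_pos[of 0] by simp
  next
    case 3
    have "norm (G 1 (A 0 v) m) \<le> C * \<nu> 1 * (\<mu> m / \<mu> 1) powr (- \<beta>) * norm (A 0 v)"
      by (rule G_stable) simp
    also have "\<dots> \<le> C * \<nu> 1 * (\<mu> m / \<mu> 1) powr (- \<beta>) * (norm (A 0) * norm v)"
      using C_nonneg \<nu>_ge_1[of 1] by (intro mult_left_mono norm_blinfun) auto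
    \<comment> \<open>The estimate from time 1 is rebased to time 0, at the cost of a constant
      factor included in \<open>D\<close>.\<close>
    also have "(\<mu> m / \<mu> 1) powr (- \<beta>) = (\<mu> 1 / \<mu> 0) powr \<beta> * (\<mu> m / \<mu> 0) powr (- \<beta>)"
      using \<mu>_pos[of 0] \<mu>_pos[of 1] \<mu>_pos[of m]
      by (simp add: powr_divide less_imp_le powr_minus field_simps)
    also have "C * \<nu> 1 * ((\<mu> 1 / \<mu> 0) powr \<beta> * (\<mu> m / \<mu> 0) powr (- \<beta>)) * (norm (A 0) * norm v)
        = K * (\<mu> 1 / \<mu> 0) powr \<beta> * 1 * (\<mu> m / \<mu> 0) powr (- \<beta>) * norm v"
      by (simp add: K_def)
    also have "\<dots> \<le> D * \<nu> 0 * (\<mu> m / \<mu> 0) powr (- \<beta>) * norm v"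
      using D_ge(3) D_pos \<nu>_ge_1[of 0] by (intro mult_right_mono mult_mono) auto
    finally show ?thesis
      using 3 by (simp add: Q_0_forward)
  qed
qed

section \<open>Stable and unstable subspaces and the splitting between them\<close>

lemma subspace_S: "subspace (S n)"
proof (rule subspaceI)
  fix u v assume "u \<in> S n" "v \<in> S n"
  then obtain B B' where "\<And>m. n \<le> m \<Longrightarrow> \<mu> m powr \<beta> * norm (transition A m n u) \<le> B"
    "\<And>m. n \<le> m \<Longrightarrow> \<mu> m powr \<beta> * norm (transition A m n v) \<le> B'" by (auto simp: S_def)
  moreover have "\<mu> m powr \<beta> * norm (transition A m n (u + v)) \<le>
      \<mu> m powr \<beta> * norm (transition A m n u) + \<mu> m powr \<beta> * norm (transition A m n v)" for m
    unfolding blinfun.add_right distrib_left[symmetric]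
    by (intro mult_left_mono norm_triangle_ineq) simp
  ultimately have "\<mu> m powr \<beta> * norm (transition A m n (u + v)) \<le> B + B'" if "n \<le> m" for m
    using that by (meson add_mono order_trans)
  then show "u + v \<in> S n" by (auto simp: S_def)
next
  fix c v assume "v \<in> S n"
  then obtain B where B: "\<And>m. n \<le> m \<Longrightarrow> \<mu> m powr \<beta> * norm (transition A m n v) \<le> B"
    by (auto simp: S_def)
  have "\<mu> m powr \<beta> * norm (transition A m n (c *\<^sub>R v)) \<le> \<bar>c\<bar> * B" if "n \<le> m" for m
    using mult_left_mono[OF B[OF that], of "\<bar>c\<bar>"] by (simp add: blinfun.scaleR_right mult_ac)
  then show "c *\<^sub>R v \<in> S n" by (auto simp: S_def)
qed (auto simp: S_def blinfun.zero_right)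

lemma subspace_U: "subspace (U n)"
  unfolding U_def
  by (intro linear_subspace_image subspace_Z bounded_linear.linear blinfun.bounded_linear_right)

lemma A_S: "v \<in> S n \<Longrightarrow> A n v \<in> S (Suc n)"
proof -
  assume "v \<in> S n"
  then obtain B where "\<And>m. n \<le> m \<Longrightarrow> \<mu> m powr \<beta> * norm (transition A m n v) \<le> B"
    by (auto simp: S_def)
  moreover have "transition A m (Suc n) (A n v) = transition A m n v" if "Suc n \<le> m" for m
    using transition_compose[of n "Suc n" m A v] that by simp
  ultimately have "\<mu> m powr \<beta> * norm (transition A m (Suc n) (A n v)) \<le> B" if "Suc n \<le> m" for m
    using that by simp
  then show ?thesis by (auto simp: S_def)
qed

lemma U_0 [simp]: "U 0 = Z"
  by (simp add: U_def)

lemma A_U: "A n ` U n = U (Suc n)"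
  by (simp add: U_def image_image)

text \<open>Membership in \<open>S n\<close> bounds the orbit from time \<open>n\<close> on; the
  finitely many earlier values are bounded anyway, so \<open>Z_unstable\<close> applies.\<close>

lemma transition_mem_S_imp_0:
  assumes "z \<in> Z" "transition A n 0 z \<in> S n"
  shows "z = 0"
proof -
  obtain B where B: "\<And>m. n \<le> m \<Longrightarrow> \<mu> m powr \<beta> * norm (transition A m 0 z) \<le> B"
    using assms(2) by (auto simp: S_def transition_compose)
  define f where "f m = \<mu> m powr \<beta> * norm (transition A m 0 z)" for m
  have "f m \<le> max B (Max (f ` {..n}))" for m
  proof (cases "n \<le> m")
    case True
    then show ?thesis using B by (auto simp: f_def le_max_iff_disj)
  next
    case False
    then have "f m \<le> Max (f ` {..n})" by (intro Max_ge) auto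
    then show ?thesis by simp
  qed
  then show ?thesis using Z_unstable[OF assms(1)] by (auto simp: f_def)
qed

lemma S_U_imp_0: "v \<in> S n \<Longrightarrow> v \<in> U n \<Longrightarrow> v = 0"
  unfolding U_def by (metis imageE transition_mem_S_imp_0 blinfun.zero_right)

text \<open>The difference of two points with equal images comes from some \<open>z\<close> in
  \<open>Z\<close> whose orbit vanishes at time \<open>n\<close>, hence lies in \<open>S n\<close>,
  which forces \<open>z = 0\<close>.\<close>

lemma inj_on_U:
  assumes "m \<le> n"
  shows "inj_on (transition A n m) (U m)"
proof (rule inj_onI)
  fix u v assume "u \<in> U m" "v \<in> U m" and eq: "transition A n m u = transition A n m v"
  then have "u - v \<in> U m" using subspace_U by (simp add: subspace_diff)
  then obtain z where z: "z \<in> Z" "u - v = transition A m 0 z" by (auto simp: U_def)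
  have "transition A n 0 z = transition A n m (u - v)"
    using assms z by (simp add: transition_compose)
  also have "\<dots> = 0" using eq by (simp add: blinfun.diff_right)
  finally have "z = 0"
    using transition_mem_S_imp_0[of z n] z(1) subspace_S[of n] by (simp add: subspace_0)
  then show "u = v" using z(2) by (simp add: blinfun.zero_right)
qed

lemma Q_mem_S: "Q n v \<in> S n"
proof -
  have "\<mu> m powr \<beta> * norm (transition A m n (Q n v)) \<le> D * \<nu> n * \<mu> n powr \<beta> * norm v"
    if "n \<le> m" for m
  proof -
    have "\<mu> m powr \<beta> * norm (transition A m n (Q n v))
        \<le> \<mu> m powr \<beta> * (D * \<nu> n * (\<mu> m / \<mu> n) powr (- \<beta>) * norm v)"
      using Q_forward[OF that] by (intro mult_left_mono) auto
    also have "\<dots> = D * \<nu> n * \<mu> n powr \<beta> * norm v"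
      using \<mu>_pos[of m] \<mu>_pos[of n] by (simp add: powr_divide less_imp_le powr_minus field_simps)
    finally show ?thesis .
  qed
  then show ?thesis by (auto simp: S_def)
qed

lemma R_mem_U_and_transition:
  assumes "m \<le> n"
  shows "R m n v \<in> U m \<and> transition A n m (R m n v) = v - Q n v"
proof -
  \<comment> \<open>Formulated for arbitrary indices because the case of time 0 uses it for the
    impulse at time 1.\<close>
  have pos: "- G n v m \<in> U m \<and> transition A n m (- G n v m) = v - G n v n" if mn: "m < n" for n m v
  proof
    have "G n v m \<in> U m"
      using G_backward[OF mn, of v] G_init[of n v] mn unfolding U_def by (metis gr_zeroI imageI not_less_zero)
    then show "- G n v m \<in> U m" by (rule subspace_neg[OF subspace_U])
    \<comment> \<open>Subtracting the impulse at time \<open>n\<close> leaves a homogeneous solution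
      on the times from \<open>m\<close> to \<open>n\<close>.\<close>
    define x where "x k = (if k = n then G n v k - v else G n v k)" for k
    have "transition A n m (x m) = x n"
      using mn by (intro transition_homogeneous) (auto simp: x_def G_step impulse_def)
    then show "transition A n m (- G n v m) = v - G n v n"
      using mn by (simp add: x_def blinfun.minus_right)
  qed
  have "v - Q n v \<in> U n"
  proof (cases "n = 0")
    case True
    have "- G 1 (A 0 v) 0 \<in> U 0" using pos[of 0 1 "A 0 v"] by simp
    then show ?thesis using True by (simp add: Q_def)
  next
    case False
    then have "transition A n 0 (- G n v 0) = v - G n v n" "- G n v 0 \<in> Z"
      using pos[of 0 n v] by auto
    then have "v - G n v n \<in> U n" unfolding U_def by (metis imageI)
    then show ?thesis using False by (simp add: Q_def)
  qed
  then show ?thesis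
    using pos[of m n v] assms by (auto simp: R_def Q_def)
qed

lemma diff_Q_mem_U: "v - Q n v \<in> U n"
  using R_mem_U_and_transition[of n n v] by (simp add: R_def)

text \<open>Two splittings of \<open>v\<close> differ by an element of both \<open>S n\<close> and
  \<open>U n\<close>, which is 0. Linearity, idempotence and invariance of the projections all
  follow by exhibiting a splitting.\<close>

lemma Q_unique: "s \<in> S n \<Longrightarrow> v - s \<in> U n \<Longrightarrow> Q n v = s"
  using S_U_imp_0[of "Q n v - s" n] subspace_diff[OF subspace_S Q_mem_S, of s n v]
    subspace_diff[OF subspace_U _ diff_Q_mem_U, of "v - s" n v]
  by simp

lemma Q_add: "Q n (u + v) = Q n u + Q n v"
proof (rule Q_unique)
  show "Q n u + Q n v \<in> S n" by (intro subspace_add[OF subspace_S] Q_mem_S)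
  show "u + v - (Q n u + Q n v) \<in> U n"
    using subspace_add[OF subspace_U diff_Q_mem_U diff_Q_mem_U, of u n v] by (simp add: algebra_simps)
qed

lemma Q_scaleR: "Q n (c *\<^sub>R v) = c *\<^sub>R Q n v"
proof (rule Q_unique)
  show "c *\<^sub>R Q n v \<in> S n" by (intro subspace_scale[OF subspace_S] Q_mem_S)
  show "c *\<^sub>R v - c *\<^sub>R Q n v \<in> U n"
    using subspace_scale[OF subspace_U diff_Q_mem_U, of c v n] by (simp add: algebra_simps)
qed

lemma Q_le: "norm (Q n v) \<le> D * \<nu> n * norm v"
  using Q_forward[of n n v] \<mu>_pos[of n] by simp

lemma bounded_linear_Q: "bounded_linear (Q n)"
  by (rule bounded_linear_intro[of _ "D * \<nu> n"]) (simp_all add: Q_add Q_scaleR Q_le mult.commute[of "norm _"])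

lemma R_le:
  assumes "m \<le> n"
  shows "norm (R m n v) \<le> D * \<nu> n * (\<mu> n / \<mu> m) powr (- \<beta>) * norm v"
proof -
  consider "m < n" | "m = n" "0 < n" | "m = n" "n = 0" using assms by linarith
  then show ?thesis
  proof cases
    case 1
    then show ?thesis
      using G_unstable[of n v m] C_le_D[of n "\<mu> n / \<mu> m" "- \<beta>" v] by (simp add: R_def)
  next
    case 2
    have "norm (v - G n v n) \<le> norm v + norm (G n v n)" by (rule norm_triangle_ineq4)
    also have "norm (G n v n) \<le> C * \<nu> n * norm v"
      using G_stable[OF 2(2), of v n] \<mu>_pos[of n] by simp
    also have "norm v + C * \<nu> n * norm v \<le> \<nu> n * norm v + C * \<nu> n * norm v"
      using mult_right_mono[OF \<nu>_ge_1[of n], of "norm v"] by simp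
    also have "\<dots> = (1 + C) * \<nu> n * norm v" by (simp add: algebra_simps)
    also have "\<dots> \<le> D * \<nu> n * norm v"
      using D_ge(1) \<nu>_ge_1[of n] by (intro mult_right_mono) auto
    finally show ?thesis using 2 \<mu>_pos[of n] by (simp add: R_def Q_def)
  next
    case 3
    have "norm (G 1 (A 0 v) 0) \<le> K * 1 * norm v" using G_1_0_le by simp
    also have "\<dots> \<le> D * \<nu> 0 * norm v"
      using D_ge(2) D_pos \<nu>_ge_1[of 0] by (intro mult_right_mono mult_mono) auto
    finally show ?thesis using 3 \<mu>_pos[of 0] by (simp add: R_def Q_def)
  qed
qed

text \<open>The transition is injective on \<open>U m\<close>; this transfers linearity from
  \<open>Q n\<close> to \<open>R m n\<close>.\<close>

lemma R_unique: "m \<le> n \<Longrightarrow> u \<in> U m \<Longrightarrow> transition A n m u = v - Q n v \<Longrightarrow> R m n v = u"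
  using R_mem_U_and_transition[of m n v] inj_on_U[of m n] by (metis inj_onD)

lemma bounded_linear_R:
  assumes mn: "m \<le> n"
  shows "bounded_linear (R m n)"
proof (rule bounded_linear_intro[of _ "D * \<nu> n * (\<mu> n / \<mu> m) powr (- \<beta>)"])
  note R = R_mem_U_and_transition[OF mn]
  show "R m n (u + v) = R m n u + R m n v" for u v
    using R[of u] R[of v]
    by (intro R_unique mn) (auto simp: subspace_add[OF subspace_U] blinfun.add_right Q_add)
  show "R m n (c *\<^sub>R v) = c *\<^sub>R R m n v" for c v
    using R[of v]
    by (intro R_unique mn)
      (auto simp: subspace_scale[OF subspace_U] blinfun.scaleR_right Q_scaleR scaleR_right_diff_distrib)
  show "norm (R m n v) \<le> norm v * (D * \<nu> n * (\<mu> n / \<mu> m) powr (- \<beta>))" for v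
    using R_le[OF mn] by (simp add: mult.commute)
qed

text \<open>The projections are the maps \<open>Q n\<close>, with kernels \<open>U n\<close>. On
  these the dynamics is bijective: onto because \<open>U (Suc n)\<close> is the image of
  \<open>U n\<close>, injective by \<open>inj_on_U\<close>. Hence \<open>R\<close> is the backward
  evolution.\<close>

theorem dichotomy: "dichotomy \<mu> \<nu> A"
proof -
  define P where "P n = Blinfun (Q n)" for n
  have P [simp]: "blinfun_apply (P n) = Q n" for n
    by (simp add: P_def bounded_linear_Blinfun_apply bounded_linear_Q)
  have ker: "ker_blinfun (P n) = U n" for n
  proof -
    have "Q n v = 0 \<longleftrightarrow> v \<in> U n" for v
      using diff_Q_mem_U[of v n] Q_unique[of 0 n v] subspace_0[OF subspace_S] by auto
    then show ?thesis by (simp add: ker_blinfun_def)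
  qed
  have backward: "(\<lambda>v. backward_transition A P m n (v - P n v)) = R m n" if mn: "m \<le> n" for m n
    using R_mem_U_and_transition[OF mn] inj_on_U[OF mn]
    by (intro ext) (auto simp: backward_transition_def ker intro!: inv_into_f_eq)
  show ?thesis
    unfolding dichotomy_def
  proof (rule exI[of _ P], intro conjI, goal_cases)
    case 1
    show ?case
      using Q_unique[OF Q_mem_S] subspace_0[OF subspace_U] by (intro allI blinfun_eqI) simp
  next
    case 2
    show ?case
    proof (intro allI blinfun_eqI)
      fix n v
      \<comment> \<open>\<open>A n\<close> carries the splitting of \<open>v\<close> at time
        \<open>n\<close> to a splitting of \<open>A n v\<close> at the next time.\<close>
      have "A n v - A n (Q n v) \<in> U (Suc n)"
        using diff_Q_mem_U[of v n] A_U[of n] by (auto simp flip: blinfun.diff_right)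
      then show "(A n o\<^sub>L P n) v = (P (Suc n) o\<^sub>L A n) v"
        using Q_unique[OF A_S[OF Q_mem_S]] by simp
    qed
  next
    case 3
    show ?case
    proof
      fix n
      show "bij_betw (A n) (ker_blinfun (P n)) (ker_blinfun (P (Suc n)))"
        using inj_on_U[of n "Suc n"] A_U[of n] by (simp add: bij_betw_def ker inj_on_def)
    qed
  next
    case 4
    show ?case
    proof (rule exI[of _ D], rule exI[of _ \<beta>], intro conjI allI impI D_pos \<beta>_pos)
      fix m n :: nat
      assume "n \<le> m"
      then show "norm (transition A m n o\<^sub>L P n) \<le> D * \<nu> n * (\<mu> m / \<mu> n) powr (- \<beta>)"
        using Q_forward[of n m] by (intro norm_blinfun_bound ratio_nonneg) simp
    next
      fix m n :: nat
      assume mn: "m \<le> n"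
      show "bounded_linear (\<lambda>v. backward_transition A P m n (v - P n v))"
        unfolding backward[OF mn] by (rule bounded_linear_R[OF mn])
      show "onorm (\<lambda>v. backward_transition A P m n (v - P n v))
          \<le> D * \<nu> n * (\<mu> n / \<mu> m) powr (- \<beta>)"
        unfolding backward[OF mn] by (intro onorm_bound ratio_nonneg R_le[OF mn])
    qed
  qed
qed

end

section \<open>From the two admissibility conditions to a Green function\<close>

theorem theorem3p2:
  fixes A :: "nat \<Rightarrow> 'a::banach \<Rightarrow>\<^sub>L 'a"
    and \<mu> \<nu> :: "nat \<Rightarrow> real"
  assumes "growth_rate \<mu>"
    and "\<And>n. 1 \<le> \<nu> n"
    and "\<exists>(Z :: 'a set) (\<beta> :: real). subspace Z \<and> closed Z \<and> 0 < \<beta> \<and>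
      (\<forall>y \<in> l1_weighted_0 \<mu> \<nu> \<beta>. \<exists>!x. x \<in> linf_weighted_init \<mu> \<beta> Z \<and>
         (\<forall>n. x (Suc n) - A n (x n) = y (Suc n))) \<and>
      (\<forall>y \<in> l1_weighted_0 \<mu> \<nu> (- \<beta>). \<exists>!x. x \<in> linf_weighted_init \<mu> (- \<beta>) Z \<and>
         (\<forall>n. x (Suc n) - A n (x n) = y (Suc n)))"
  shows "dichotomy \<mu> \<nu> A"
proof -
  obtain Z \<beta> where Z: "subspace Z" "closed Z" and \<beta>: "0 < \<beta>"
    and adm: "\<And>\<gamma> y. \<gamma> \<in> {\<beta>, - \<beta>} \<Longrightarrow> y \<in> l1_weighted_0 \<mu> \<nu> \<gamma> \<Longrightarrow>
      \<exists>!x. x \<in> linf_weighted_init \<mu> \<gamma> Z \<and> (\<forall>n. x (Suc n) - A n (x n) = y (Suc n))"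
    using assms(3) by (metis insertE singletonD)
  have mono: "strict_mono \<mu>" and pos: "\<And>n. 0 < \<mu> n"
    using assms(1) by (auto simp: growth_rate_def)
  have wadm: "weighted_admissibility A (\<lambda>n. \<mu> n powr \<gamma>) (\<lambda>n. \<mu> n powr \<gamma> * \<nu> n) Z"
    if "\<gamma> \<in> {\<beta>, - \<beta>}" for \<gamma>
  proof
    fix y :: "nat \<Rightarrow> 'a" assume "y 0 = 0" "summable (\<lambda>n. \<mu> n powr \<gamma> * \<nu> n * norm (y n))"
    then have "y \<in> l1_weighted_0 \<mu> \<nu> \<gamma>" by (simp add: l1_weighted_0_def l1_weighted_def)
    from adm[OF that this] show "\<exists>!x. bounded_solution A (\<lambda>n. \<mu> n powr \<gamma>) Z y x"
      by (simp add: bounded_solution_def linf_weighted_init_def linf_weighted_def conj_assoc)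
  next
    fix n
    show "0 < \<mu> n powr \<gamma>" using pos[of n] by simp
    show "0 < \<mu> n powr \<gamma> * \<nu> n" using pos[of n] less_le_trans[OF zero_less_one assms(2)[of n]] by simp
  qed (fact Z)+
  interpret p: weighted_admissibility A "\<lambda>n. \<mu> n powr \<beta>" "\<lambda>n. \<mu> n powr \<beta> * \<nu> n" Z
    by (rule wadm) simp
  interpret m: weighted_admissibility A "\<lambda>n. \<mu> n powr (- \<beta>)" "\<lambda>n. \<mu> n powr (- \<beta>) * \<nu> n" Z
    by (rule wadm) simp
  \<comment> \<open>A solution bounded in the weight with exponent \<beta> is also bounded with
    exponent -\<beta>, since \<mu> is bounded below by its first value; uniqueness for -\<beta> then
    identifies the two solutions.\<close>
  have same: "m.sol (impulse n v) = p.sol (impulse n v)" if n: "0 < n" for n v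
  proof (rule m.sol_eqI[OF m.admissible_impulse[OF n]])
    note x = p.sol[OF p.admissible_impulse[OF n, of v]]
    have "bdd_above (range (\<lambda>k. \<mu> k powr (- \<beta>) * norm (p.sol (impulse n v) k)))"
    proof (rule bdd_aboveI2)
      fix k
      have "\<mu> 0 \<le> \<mu> k" using mono by (simp add: strict_mono_less_eq)
      then have "\<mu> k powr (- (2 * \<beta>)) \<le> \<mu> 0 powr (- (2 * \<beta>))"
        using pos[of 0] \<beta> by (intro powr_mono2') auto
      then have "\<mu> k powr (- (2 * \<beta>)) * (\<mu> k powr \<beta> * norm (p.sol (impulse n v) k))
          \<le> \<mu> 0 powr (- (2 * \<beta>)) * p.solnorm (impulse n v)"
        by (intro mult_mono p.solnorm_upper p.admissible_impulse n) auto
      moreover have "\<mu> k powr (- (2 * \<beta>)) * \<mu> k powr \<beta> = \<mu> k powr (- \<beta>)"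
        by (simp flip: powr_add)
      ultimately show "\<mu> k powr (- \<beta>) * norm (p.sol (impulse n v) k)
          \<le> \<mu> 0 powr (- (2 * \<beta>)) * p.solnorm (impulse n v)"
        by (simp flip: mult.assoc)
    qed
    with x show "bounded_solution A (\<lambda>k. \<mu> k powr (- \<beta>)) Z (impulse n v) (p.sol (impulse n v))"
      by (simp add: bounded_solution_def)
  qed
  obtain C1 where C1: "\<And>n v m. 0 < n \<Longrightarrow>
      \<mu> m powr \<beta> * norm (p.sol (impulse n v) m) \<le> C1 * (\<mu> n powr \<beta> * \<nu> n) * norm v"
    using p.impulse_bound by blast
  obtain C2 where C2: "\<And>n v m. 0 < n \<Longrightarrow>
      \<mu> m powr (- \<beta>) * norm (p.sol (impulse n v) m) \<le> C2 * (\<mu> n powr (- \<beta>) * \<nu> n) * norm v"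
    using m.impulse_bound same by metis
  \<comment> \<open>Absolute values make \<open>C\<close> nonnegative and an upper bound for both
    constants, whose signs are unknown.\<close>
  define C where "C = \<bar>C1\<bar> + \<bar>C2\<bar>"
  \<comment> \<open>Dividing a weighted bound by the weight at \<open>k\<close> leaves only the
    ratio of the two values of \<mu>.\<close>
  have bound: "t \<le> C * \<nu> n * (\<mu> k / \<mu> n) powr (- \<gamma>) * norm v"
    if t: "\<mu> k powr \<gamma> * t \<le> c * (\<mu> n powr \<gamma> * \<nu> n) * norm v" and c: "c \<le> C"
    for t c \<gamma> k n and v :: 'a
  proof -
    have "\<mu> k powr \<gamma> * t \<le> C * (\<mu> n powr \<gamma> * \<nu> n) * norm v"
      using t c pos[of n] assms(2)[of n]
      by (elim order_trans, intro mult_right_mono) auto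
    then show ?thesis
      using pos[of k] pos[of n] by (simp add: powr_divide less_imp_le powr_minus field_simps)
  qed
  have "green_function A \<mu> \<nu> \<beta> C Z (\<lambda>n v. p.sol (impulse n v))"
  proof
    fix n k :: nat and v :: 'a assume n: "0 < n"
    note x = p.sol[OF p.admissible_impulse[OF n, of v], unfolded bounded_solution_def]
    show "p.sol (impulse n v) 0 \<in> Z" using x by blast
    have "p.sol (impulse n v) (Suc k) - A k (p.sol (impulse n v) k) = impulse n v (Suc k)"
      using x by blast
    then show "p.sol (impulse n v) (Suc k) = A k (p.sol (impulse n v) k) + impulse n v (Suc k)"
      by (simp add: algebra_simps)
    show "norm (p.sol (impulse n v) k) \<le> C * \<nu> n * (\<mu> k / \<mu> n) powr (- \<beta>) * norm v"
      by (rule bound[OF C1[OF n]]) (simp add: C_def)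
    \<comment> \<open>The exponent -\<beta> inverts the ratio and so gives the backward
      estimate.\<close>
    have "norm (p.sol (impulse n v) k) \<le> C * \<nu> n * (\<mu> k / \<mu> n) powr (- (- \<beta>)) * norm v"
      by (rule bound[OF C2[OF n]]) (simp add: C_def)
    also have "(\<mu> k / \<mu> n) powr (- (- \<beta>)) = (\<mu> n / \<mu> k) powr (- \<beta>)"
      using pos[of k] pos[of n] by (simp add: powr_divide less_imp_le powr_minus field_simps)
    finally show "norm (p.sol (impulse n v) k) \<le> C * \<nu> n * (\<mu> n / \<mu> k) powr (- \<beta>) * norm v" .
  next
    fix z B assume z: "z \<in> Z" and B: "\<And>k. \<mu> k powr \<beta> * norm (transition A k 0 z) \<le> B"
    \<comment> \<open>The orbit of \<open>z\<close> and the zero sequence both solve the problem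
      with zero right-hand side, so uniqueness for the exponent \<beta> makes them equal.\<close>
    have "p.admissible (\<lambda>_. 0)" by (simp add: p.admissible_def)
    note eqI = p.sol_eqI[OF this]
    have "p.sol (\<lambda>_. 0) = (\<lambda>k. transition A k 0 z)"
      using z by (intro eqI) (auto simp: bounded_solution_def intro: bdd_aboveI2[OF B])
    moreover have "p.sol (\<lambda>_. 0) = (\<lambda>_. 0)"
      using subspace_0[OF Z(1)] by (intro eqI) (simp add: bounded_solution_def blinfun.zero_right)
    ultimately show "z = 0" by (auto dest: fun_cong[of _ _ 0])
  qed (use mono pos assms(2) \<beta> Z in \<open>auto simp: C_def\<close>)
  then show ?thesis by (rule green_function.dichotomy)
qed

end
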